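(* Let $S$ be a compact Hausdorff space and let $\mathcal A$ be a closed linear subalgebra of $C(S)$. Regard $\mathcal A\subseteq C(S)\subseteq C(S)^{**}$ via the canonical embedding. Then the triplet $(C(S)^{**}, B_{\mathcal A}, \mathcal{CB}(C(S)^{**}))$ has property-$(P_1)$, and the map $\mathrm{cent}_{B_{\mathcal A}}(\cdot)$ is uniformly Hausdorff metric continuous on $\mathcal{CB}(C(S)^{**})$.
   Context: All Banach spaces are real. $C(S)$ is the space of real-valued continuous functions on $S$ with the supremum norm; a subalgebra need not contain the constants. For a Banach space $E$, $B_E$ is its closed unit ball and $\mathcal{CB}(E)$ is the class of non-empty closed bounded subsets of $E$, with Hausdorff metric $d_H(A,B)=\inf\{t>0: A\subseteq B+tB_E,\ B\subseteq A+tB_E\}$. For $v\in E$ and a non-empty bounded set $F\subseteq E$, $r(v,F)=\sup_{z\in F}\|v-z\|$. For a non-empty closed convex $V\subseteq E$: $\mathrm{rad}_V(F)=\inf_{v\in V}r(v,F)$, $\mathrm{cent}_V(F)=\{v\in V: r(v,F)=\mathrm{rad}_V(F)\}$, and for $\delta>0$, $\mathrm{cent}_V(F,\delta)=\{v\in V: r(v,F)\le \mathrm{rad}_V(F)+\delta\}$. For $\mathscr F\subseteq\mathcal{CB}(E)$, the pair $(V,\mathscr F)$ has the restricted center property (r.c.p.) if $\mathrm{cent}_V(F)\ne\emptyset$ for every $F\in\mathscr F$. The triplet $(E,V,\mathscr F)$ has property-$(P_1)$ if $(V,\mathscr F)$ has r.c.p. and for every $\varepsilon>0$ and $F\in\mathscr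 F$ there is $\delta>0$ with $\mathrm{cent}_V(F,\delta)\subseteq\mathrm{cent}_V(F)+\varepsilon B_E$. The map $\mathrm{cent}_V(\cdot)$ is uniformly Hausdorff metric continuous on $\mathcal{CB}(E)$ if it is uniformly continuous as a single-valued map from $(\mathcal{CB}(E),d_H)$ to $(\mathcal{CB}(E),d_H)$. *)

theory Defs
  imports "HOL-Analysis.Analysis"
begin

(* The space C(S) is the type of bounded continuous functions on a type of class t2_space
   whose universe is compact (so boundedness is automatic), with the supremum norm. *)

definition bcontfun_times ::
  "('a::topological_space \<Rightarrow>\<^sub>C real) \<Rightarrow> ('a \<Rightarrow>\<^sub>C real) \<Rightarrow> ('a \<Rightarrow>\<^sub>C real)" where
  "bcontfun_times f g = Bcontfun (\<lambda>x. apply_bcontfun f x * apply_bcontfun g x)"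

lemma apply_bcontfun_times [simp]:
  "apply_bcontfun (bcontfun_times f g) x = apply_bcontfun f x * apply_bcontfun g x"
proof -
  have "(\<lambda>x. apply_bcontfun f x * apply_bcontfun g x) \<in> bcontfun"
  proof (rule bcontfun_normI)
    show "continuous_on UNIV (\<lambda>x. apply_bcontfun f x * apply_bcontfun g x)"
      by (intro continuous_on_mult) simp_all
    show "norm (apply_bcontfun f x * apply_bcontfun g x) \<le> norm f * norm g" for x
      by (simp only: norm_mult) (intro mult_mono norm_bounded norm_ge_zero)
  qed
  then show ?thesis
    by (simp add: bcontfun_times_def Bcontfun_inverse)
qed

(* The constant functions are not required to belong to the subalgebra. *)
definition closed_subalgebra :: "('a::topological_space \<Rightarrow>\<^sub>C real) set \<Rightarrow> bool" where
  "closed_subalgebra A \<longleftrightarrow>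
     subspace A \<and> closed A \<and> (\<forall>f\<in>A. \<forall>g\<in>A. bcontfun_times f g \<in> A)"

definition bidual_embedding ::
  "'e::real_normed_vector \<Rightarrow> (('e \<Rightarrow>\<^sub>L real) \<Rightarrow>\<^sub>L real)" where
  "bidual_embedding x = Blinfun (\<lambda>\<phi>. blinfun_apply \<phi> x)"

lemma bidual_embedding_apply [simp]:
  "blinfun_apply (bidual_embedding x) \<phi> = blinfun_apply \<phi> x"
  by (simp add: bidual_embedding_def bounded_linear_Blinfun_apply blinfun.bounded_linear_left)

definition closed_bounded_sets :: "'e::real_normed_vector set set" where
  "closed_bounded_sets = {F. F \<noteq> {} \<and> closed F \<and> bounded F}"

(* The set B + t B_E, where B_E is the closed unit ball of the ambient space. *)
definition enlarge :: "'e::real_normed_vector set \<Rightarrow> real \<Rightarrow> 'e set" where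
  "enlarge B t = {b + t *\<^sub>R u | b u. b \<in> B \<and> u \<in> cball 0 1}"

definition hausdorff_dist :: "'e::real_normed_vector set \<Rightarrow> 'e set \<Rightarrow> real" where
  "hausdorff_dist A B = Inf {t. t > 0 \<and> A \<subseteq> enlarge B t \<and> B \<subseteq> enlarge A t}"

definition far_radius :: "'e::real_normed_vector \<Rightarrow> 'e set \<Rightarrow> real" where
  "far_radius v F = (SUP z\<in>F. norm (v - z))"

definition rad :: "'e::real_normed_vector set \<Rightarrow> 'e set \<Rightarrow> real" where
  "rad V F = (INF v\<in>V. far_radius v F)"

definition cent :: "'e::real_normed_vector set \<Rightarrow> 'e set \<Rightarrow> 'e set" where
  "cent V F = {v \<in> V. far_radius v F = rad V F}"

definition cent_approx :: "'e::real_normed_vector set \<Rightarrow> 'e set \<Rightarrow> real \<Rightarrow> 'e set" where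
  "cent_approx V F \<delta> = {v \<in> V. far_radius v F \<le> rad V F + \<delta>}"

definition restricted_center_property ::
  "'e::real_normed_vector set \<Rightarrow> 'e set set \<Rightarrow> bool" where
  "restricted_center_property V \<F> \<longleftrightarrow> (\<forall>F\<in>\<F>. cent V F \<noteq> {})"

(* The ambient space E of the triplet (E, V, F) is the type of the elements of V. *)
definition property_P1 :: "'e::real_normed_vector set \<Rightarrow> 'e set set \<Rightarrow> bool" where
  "property_P1 V \<F> \<longleftrightarrow>
     restricted_center_property V \<F> \<and>
     (\<forall>\<epsilon>>0. \<forall>F\<in>\<F>. \<exists>\<delta>>0. cent_approx V F \<delta> \<subseteq> enlarge (cent V F) \<epsilon>)"

(* The first conjunct says that the map takes its values in the closed bounded non-empty sets. *)
definition cent_uniformly_hausdorff_continuous :: "'e::real_normed_vector set \<Rightarrow> bool" where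
  "cent_uniformly_hausdorff_continuous V \<longleftrightarrow>
     (\<forall>F\<in>closed_bounded_sets. cent V F \<in> closed_bounded_sets) \<and>
     (\<forall>\<epsilon>>0. \<exists>\<delta>>0. \<forall>F\<in>closed_bounded_sets. \<forall>G\<in>closed_bounded_sets.
        hausdorff_dist F G < \<delta> \<longrightarrow> hausdorff_dist (cent V F) (cent V G) < \<epsilon>)"

end

theory Submission
  imports Defs
begin

text \<open>Let \<open>v\<close> and \<open>w\<close> be in the unit ball of the algebra, with \<open>r(v, F) \<le> a + \<delta>\<close> and
  \<open>r(w, F) \<le> a\<close>. Truncating \<open>w\<close> to the band \<open>[v - \<delta>, v + \<delta>]\<close> gives an element \<open>u\<close> of the ball
  within \<open>\<delta>\<close> of \<open>v\<close>. As \<open>u\<close> lies above \<open>min w (v + \<delta>)\<close> and below \<open>max w (v - \<delta>)\<close>, and order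
  bounds in the bidual pass to minima and maxima, \<open>r(u, F) \<le> a\<close>. Repeating this with \<open>\<delta>\<close> halved
  each time, every \<open>\<delta>\<close>-approximate centre is within \<open>2\<delta>\<close> of a centre, with no dependence on
  \<open>F\<close>; both claims follow from this.\<close>

section \<open>Chebyshev centres\<close>

lemma far_radius_le_iff:
  fixes F :: "'e::real_normed_vector set"
  assumes "F \<noteq> {}" "bounded F"
  shows "far_radius v F \<le> a \<longleftrightarrow> (\<forall>z\<in>F. norm (v - z) \<le> a)"
proof -
  obtain B where B: "\<forall>z\<in>F. norm z \<le> B"
    using \<open>bounded F\<close> by (auto simp: bounded_iff)
  have "bdd_above ((\<lambda>z. norm (v - z)) ` F)"
    using B by (intro bdd_aboveI2[where M = "norm v + B"]) (meson add_left_mono norm_triangle_ineq4 order_trans)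
  then show ?thesis
    using \<open>F \<noteq> {}\<close> by (simp add: far_radius_def cSUP_le_iff)
qed

lemma far_radius_nonneg:
  fixes F :: "'e::real_normed_vector set"
  assumes "F \<noteq> {}" "bounded F"
  shows "0 \<le> far_radius v F"
  using far_radius_le_iff[OF assms, of v "far_radius v F"] assms(1)
  by (meson all_not_in_conv norm_ge_zero order_refl order_trans)

lemma rad_le:
  fixes F :: "'e::real_normed_vector set"
  assumes "F \<noteq> {}" "bounded F" "v \<in> V"
  shows "rad V F \<le> far_radius v F"
  unfolding rad_def using far_radius_nonneg[OF assms(1,2)]
  by (intro cINF_lower bdd_belowI2[where m = 0] assms(3)) auto

section \<open>Enlargements, the Hausdorff distance and the stability of radii\<close>

lemma enlargeI:
  assumes "b \<in> B" "norm (x - b) \<le> t" "0 < t"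
  shows "x \<in> enlarge B t"
proof -
  have "x = b + t *\<^sub>R ((x - b) /\<^sub>R t)" "(x - b) /\<^sub>R t \<in> cball 0 1"
    using assms by (auto simp: divide_le_eq divide_inverse_commute[symmetric])
  then show ?thesis
    unfolding enlarge_def using assms(1) by blast
qed

lemma enlargeE:
  assumes "x \<in> enlarge B t" "0 \<le> t"
  obtains b where "b \<in> B" "norm (x - b) \<le> t"
proof -
  obtain b u where "b \<in> B" "norm u \<le> 1" "x = b + t *\<^sub>R u"
    using assms(1) by (auto simp: enlarge_def)
  then show thesis
    using that[of b] assms(2) by (simp add: mult_left_le)
qed

lemma hausdorff_dist_le:
  assumes "0 < t" "A \<subseteq> enlarge B t" "B \<subseteq> enlarge A t"
  shows "hausdorff_dist A B \<le> t"
  unfolding hausdorff_dist_def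
  using assms by (intro cInf_lower bdd_belowI[where m = 0]) auto

lemma hausdorff_dist_less:
  assumes "A \<in> closed_bounded_sets" "B \<in> closed_bounded_sets" "hausdorff_dist A B < \<delta>"
  obtains t where "0 < t" "t < \<delta>" "A \<subseteq> enlarge B t" "B \<subseteq> enlarge A t"
proof -
  let ?T = "{t. t > 0 \<and> A \<subseteq> enlarge B t \<and> B \<subseteq> enlarge A t}"
  obtain M where M: "M > 0" "\<And>x. x \<in> A \<union> B \<Longrightarrow> norm x \<le> M"
    using assms(1,2) bounded_Un[of A B] by (auto simp: closed_bounded_sets_def bounded_pos)
  obtain a b where ab: "a \<in> A" "b \<in> B"
    using assms(1,2) by (auto simp: closed_bounded_sets_def)
  have close: "norm (x - y) \<le> 2 * M" if "x \<in> A \<union> B" "y \<in> A \<union> B" for x y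
    using M(2)[OF that(1)] M(2)[OF that(2)] norm_triangle_ineq4[of x y] by linarith
  \<comment> \<open>The infimum of an empty set of reals carries no information, so a member is
    exhibited: twice a common norm bound is at least every distance between points of the two
    sets.\<close>
  have "2 * M \<in> ?T"
    using M(1) ab close enlargeI[OF ab(1)] enlargeI[OF ab(2)] by auto
  then have "\<exists>t\<in>?T. t < \<delta>"
    using assms(3) cInf_lessD[of ?T \<delta>] unfolding hausdorff_dist_def by blast
  then show thesis
    using that by blast
qed

lemma far_radius_le_enlarge:
  fixes F G :: "'e::real_normed_vector set"
  assumes F: "F \<noteq> {}" "bounded F" and G: "G \<noteq> {}" "bounded G"
    and "G \<subseteq> enlarge F t" "0 \<le> t"
  shows "far_radius v G \<le> far_radius v F + t"
  unfolding far_radius_le_iff[OF G]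
proof
  fix z assume "z \<in> G"
  then obtain b where b: "b \<in> F" "norm (z - b) \<le> t"
    using assms(5,6) enlargeE[of z F t] by blast
  have "norm (v - b) \<le> far_radius v F"
    using far_radius_le_iff[OF F, of v "far_radius v F"] b(1) by simp
  then show "norm (v - z) \<le> far_radius v F + t"
    using b(2) norm_triangle_ineq4[of "v - b" "z - b"] by simp
qed

lemma rad_le_enlarge:
  fixes F G :: "'e::real_normed_vector set"
  assumes F: "F \<noteq> {}" "bounded F" and G: "G \<noteq> {}" "bounded G"
    and "G \<subseteq> enlarge F t" "0 \<le> t" "V \<noteq> {}"
  shows "rad V G \<le> rad V F + t"
proof -
  have "rad V G - t \<le> rad V F"
    unfolding rad_def[of V F]
  proof (rule cINF_greatest[OF \<open>V \<noteq> {}\<close>])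
    fix v assume "v \<in> V"
    then show "rad V G - t \<le> far_radius v F"
      using rad_le[OF G, of v V] far_radius_le_enlarge[OF F G assms(5,6), of v] by simp
  qed
  then show ?thesis by simp
qed

section \<open>Centres relative to a set with the truncation property\<close>

text \<open>\<open>u\<close> is chosen before \<open>z\<close> and \<open>a\<close>, so one
  \<open>u\<close> serves all points of a set \<open>F\<close> at once, whatever \<open>F\<close>
  is. Together with completeness, non-emptiness and boundedness this is all that this part uses
  about the unit ball.\<close>

definition truncation_property :: "'e::real_normed_vector set \<Rightarrow> bool" where
  "truncation_property V \<longleftrightarrow>
     (\<forall>v\<in>V. \<forall>w\<in>V. \<forall>\<delta>>0. \<exists>u\<in>V. norm (u - v) \<le> \<delta> \<and>
        (\<forall>z a. norm (w - z) \<le> a \<longrightarrow> norm (v - z) \<le> a + \<delta> \<longrightarrow> norm (u - z) \<le> a))"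

lemma near_centre:
  fixes V F :: "'e::real_normed_vector set"
  assumes "complete V" and trunc: "truncation_property V"
    and F: "F \<noteq> {}" "bounded F" and "0 < \<delta>"
    and v: "v \<in> V" "far_radius v F \<le> rad V F + \<delta>"
  obtains c where "c \<in> cent V F" "norm (c - v) \<le> 2 * \<delta>"
proof -
  define d where "d n = \<delta> / 2 ^ n" for n :: nat
  have d_pos: "0 < d n" for n
    using \<open>0 < \<delta>\<close> by (simp add: d_def)
  \<comment> \<open>The clause for \<open>n = 0\<close> pins the start of the sequence to
    \<open>v\<close>, so that the limit can be compared with \<open>v\<close>.\<close>
  define P where "P n x \<longleftrightarrow> x \<in> V \<and> far_radius x F \<le> rad V F + d n \<and> (n = 0 \<longrightarrow> x = v)" for n x
  have "\<exists>f. \<forall>n. P n (f n) \<and> norm (f (Suc n) - f n) \<le> d n"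
  proof (rule dependent_nat_choice)
    show "\<exists>x. P 0 x"
      using v by (auto simp: P_def d_def)
  next
    fix x n assume x: "P n x"
    \<comment> \<open>This \<open>w\<close> may be far from \<open>x\<close>; truncation will
      replace it by a point \<open>u\<close> near \<open>x\<close>.\<close>
    have "\<exists>w\<in>V. far_radius w F < rad V F + d (Suc n)"
      using v(1) d_pos cInf_lessD[of "(\<lambda>v. far_radius v F) ` V" "rad V F + d (Suc n)"]
      by (auto simp: rad_def)
    then obtain w where w: "w \<in> V" "far_radius w F \<le> rad V F + d (Suc n)"
      by (meson less_imp_le)
    obtain u where u: "u \<in> V" "norm (u - x) \<le> d n"
      "\<And>z a. norm (w - z) \<le> a \<Longrightarrow> norm (x - z) \<le> a + d n \<Longrightarrow> norm (u - z) \<le> a"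
      using trunc x w(1) d_pos[of n] unfolding truncation_property_def P_def by meson
    have "far_radius u F \<le> rad V F + d (Suc n)"
      unfolding far_radius_le_iff[OF F]
    proof
      fix z assume z: "z \<in> F"
      have "norm (w - z) \<le> rad V F + d (Suc n)"
        using w(2) z far_radius_le_iff[OF F] by blast
      moreover have "norm (x - z) \<le> rad V F + d n"
        using x z far_radius_le_iff[OF F] unfolding P_def by blast
      \<comment> \<open>Truncation applies with \<open>a = rad V F + d (Suc n)\<close>: the bound
        \<open>rad V F + d n\<close> for \<open>x\<close> is below \<open>a + d n\<close>.\<close>
      ultimately show "norm (u - z) \<le> rad V F + d (Suc n)"
        using d_pos[of "Suc n"] by (intro u(3)) auto
    qed
    then show "\<exists>y. P (Suc n) y \<and> norm (y - x) \<le> d n"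
      using u(1,2) by (auto simp: P_def)
  qed
  then obtain f where f: "\<And>n. P n (f n)" and step: "\<And>n. norm (f (Suc n) - f n) \<le> d n"
    by blast
  \<comment> \<open>A geometric series: as \<open>d\<close> halves at each step, its sum from
    \<open>n\<close> to \<open>n + k - 1\<close> is \<open>2 * d n - 2 * d (n + k)\<close>.\<close>
  have tele: "norm (f (n + k) - f n) \<le> 2 * d n - 2 * d (n + k)" for n k
  proof (induction k)
    case (Suc k)
    have "norm (f (n + Suc k) - f n) \<le> norm (f (Suc (n + k)) - f (n + k)) + norm (f (n + k) - f n)"
      using norm_triangle_ineq[of "f (Suc (n + k)) - f (n + k)" "f (n + k) - f n"] by simp
    also have "\<dots> \<le> d (n + k) + (2 * d n - 2 * d (n + k))"
      using step Suc.IH by (intro add_mono)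
    also have "\<dots> = 2 * d n - 2 * d (n + Suc k)"
      by (simp add: d_def)
    finally show ?case .
  qed simp
  have d_lim: "d \<longlonglongrightarrow> 0"
    unfolding d_def by (rule LIMSEQ_divide_realpow_zero) simp
  have "Cauchy f"
  proof (rule CauchyI')
    fix e :: real assume "0 < e"
    then obtain M where M: "\<And>n. n \<ge> M \<Longrightarrow> d n < e / 2"
      using order_tendstoD(2)[OF d_lim, of "e / 2"] by (auto simp: eventually_sequentially)
    have "dist (f m) (f n) < e" if "m \<ge> M" "n > m" for m n
      using tele[of m "n - m"] M[OF that(1)] d_pos[of n] that(2)
      by (simp add: dist_norm norm_minus_commute)
    then show "\<exists>M. \<forall>m\<ge>M. \<forall>n>m. dist (f m) (f n) < e"
      by blast
  qed
  then obtain c where c: "c \<in> V" "f \<longlonglongrightarrow> c"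
    using \<open>complete V\<close> f unfolding complete_def P_def by blast
  have "far_radius c F \<le> rad V F"
    unfolding far_radius_le_iff[OF F]
  proof
    fix z assume z: "z \<in> F"
    have "norm (f n - z) \<le> rad V F + d n" for n
      using f z far_radius_le_iff[OF F] unfolding P_def by blast
    moreover have "(\<lambda>n. norm (f n - z)) \<longlonglongrightarrow> norm (c - z)"
      by (intro tendsto_intros c)
    moreover have "(\<lambda>n. rad V F + d n) \<longlonglongrightarrow> rad V F + 0"
      by (intro tendsto_intros d_lim)
    ultimately show "norm (c - z) \<le> rad V F"
      using LIMSEQ_le by fastforce
  qed
  then have "c \<in> cent V F"
    using c(1) rad_le[OF F c(1)] by (simp add: cent_def)
  moreover have "norm (c - v) \<le> 2 * \<delta>"
  proof (rule LIMSEQ_le_const2)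
    show "(\<lambda>n. norm (f n - v)) \<longlonglongrightarrow> norm (c - v)"
      by (intro tendsto_intros c)
    have "norm (f n - v) \<le> 2 * \<delta>" for n
      using tele[of 0 n] f[of 0] d_pos[of n] by (simp add: P_def d_def)
    then show "\<exists>N. \<forall>n\<ge>N. norm (f n - v) \<le> 2 * \<delta>"
      by blast
  qed
  ultimately show thesis
    by (rule that)
qed

lemma cent_nonempty:
  fixes V F :: "'e::real_normed_vector set"
  assumes "complete V" "truncation_property V" "V \<noteq> {}" "F \<noteq> {}" "bounded F"
  shows "cent V F \<noteq> {}"
proof -
  obtain v where v: "v \<in> V"
    using \<open>V \<noteq> {}\<close> by blast
  define \<delta> where "\<delta> = far_radius v F - rad V F + 1"
  have "0 < \<delta>" "far_radius v F \<le> rad V F + \<delta>"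
    using rad_le[OF assms(4,5) v] by (auto simp: \<delta>_def)
  then show ?thesis
    using near_centre[OF assms(1,2,4,5) _ v] by blast
qed

lemma truncation_property_imp_P1:
  fixes V :: "'e::real_normed_vector set"
  assumes "complete V" "truncation_property V" "V \<noteq> {}"
  shows "property_P1 V closed_bounded_sets"
  unfolding property_P1_def restricted_center_property_def
proof (intro conjI ballI allI impI)
  fix F :: "'e set" assume F: "F \<in> closed_bounded_sets"
  then show "cent V F \<noteq> {}"
    using cent_nonempty[OF assms] by (simp add: closed_bounded_sets_def)
next
  fix \<epsilon> :: real and F :: "'e set"
  assume \<epsilon>: "0 < \<epsilon>" and "F \<in> closed_bounded_sets"
  then have F: "F \<noteq> {}" "bounded F"
    by (auto simp: closed_bounded_sets_def)
  have "cent_approx V F (\<epsilon> / 2) \<subseteq> enlarge (cent V F) \<epsilon>"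
  proof
    fix v assume "v \<in> cent_approx V F (\<epsilon> / 2)"
    then obtain c where "c \<in> cent V F" "norm (c - v) \<le> \<epsilon>"
      using near_centre[OF assms(1,2) F, of "\<epsilon> / 2" v] \<epsilon> by (auto simp: cent_approx_def)
    then show "v \<in> enlarge (cent V F) \<epsilon>"
      using \<epsilon> by (intro enlargeI) (auto simp: norm_minus_commute)
  qed
  then show "\<exists>\<delta>>0. cent_approx V F \<delta> \<subseteq> enlarge (cent V F) \<epsilon>"
    using \<epsilon> half_gt_zero by blast
qed

lemma closed_cent:
  fixes V F :: "'e::real_normed_vector set"
  assumes "closed V" "F \<noteq> {}" "bounded F"
  shows "closed (cent V F)"
proof -
  \<comment> \<open>For \<open>v\<close> in \<open>V\<close> the inequality
    \<open>rad V F \<le> far_radius v F\<close> is automatic, so centres are cut out by the reverse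
    inequality, which describes an intersection of closed balls.\<close>
  have "cent V F = V \<inter> (\<Inter>z\<in>F. cball z (rad V F))"
  proof (rule set_eqI)
    fix v
    have "v \<in> cent V F \<longleftrightarrow> v \<in> V \<and> far_radius v F \<le> rad V F"
      using rad_le[OF assms(2,3), of v V] by (auto simp: cent_def)
    also have "\<dots> \<longleftrightarrow> v \<in> V \<inter> (\<Inter>z\<in>F. cball z (rad V F))"
      by (simp add: far_radius_le_iff[OF assms(2,3)] dist_norm norm_minus_commute)
    finally show "v \<in> cent V F \<longleftrightarrow> v \<in> V \<inter> (\<Inter>z\<in>F. cball z (rad V F))" .
  qed
  then show ?thesis
    using assms(1) by auto
qed

text \<open>Passing between \<open>F\<close> and \<open>G\<close> changes each radius, and also the
  infimum of the radii, by at most \<open>t\<close>. A centre of \<open>F\<close> is therefore a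
  \<open>2 * t\<close>-approximate centre of \<open>G\<close>, and \<open>near_centre\<close>
  doubles this to \<open>4 * t\<close>.\<close>

lemma cent_subset_enlarge:
  fixes V F G :: "'e::real_normed_vector set"
  assumes "complete V" "truncation_property V"
    and F: "F \<noteq> {}" "bounded F" and G: "G \<noteq> {}" "bounded G"
    and "0 < t" "G \<subseteq> enlarge F t" "F \<subseteq> enlarge G t"
  shows "cent V F \<subseteq> enlarge (cent V G) (4 * t)"
proof
  fix v assume "v \<in> cent V F"
  then have v: "v \<in> V" "far_radius v F = rad V F"
    by (auto simp: cent_def)
  have "far_radius v G \<le> rad V G + 2 * t"
    using far_radius_le_enlarge[OF F G, of t v] rad_le_enlarge[OF G F, of t V] v assms(7-9)
    by fastforce
  then obtain c where "c \<in> cent V G" "norm (c - v) \<le> 4 * t"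
    using near_centre[OF assms(1,2) G, of "2 * t" v] v(1) \<open>0 < t\<close> by auto
  then show "v \<in> enlarge (cent V G) (4 * t)"
    using \<open>0 < t\<close> by (intro enlargeI) (auto simp: norm_minus_commute)
qed

lemma truncation_property_imp_uniformly_continuous:
  fixes V :: "'e::real_normed_vector set"
  assumes "complete V" "truncation_property V" "V \<noteq> {}" "bounded V"
  shows "cent_uniformly_hausdorff_continuous V"
  unfolding cent_uniformly_hausdorff_continuous_def
proof (intro conjI ballI allI impI)
  fix F :: "'e set" assume "F \<in> closed_bounded_sets"
  then have F: "F \<noteq> {}" "bounded F"
    by (auto simp: closed_bounded_sets_def)
  have "cent V F \<subseteq> V"
    by (auto simp: cent_def)
  then show "cent V F \<in> closed_bounded_sets"
    using cent_nonempty[OF assms(1-3) F] closed_cent[OF complete_imp_closed[OF assms(1)] F]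
      bounded_subset[OF assms(4)] by (auto simp: closed_bounded_sets_def)
next
  fix \<epsilon> :: real assume \<epsilon>: "0 < \<epsilon>"
  have "hausdorff_dist (cent V F) (cent V G) < \<epsilon>"
    if F: "F \<in> closed_bounded_sets" and G: "G \<in> closed_bounded_sets"
      and FG: "hausdorff_dist F G < \<epsilon> / 4" for F G :: "'e set"
  proof -
    obtain t where t: "0 < t" "t < \<epsilon> / 4" "F \<subseteq> enlarge G t" "G \<subseteq> enlarge F t"
      using hausdorff_dist_less[OF F G FG] .
    have "hausdorff_dist (cent V F) (cent V G) \<le> 4 * t"
      using F G t by (intro hausdorff_dist_le cent_subset_enlarge assms)
        (auto simp: closed_bounded_sets_def)
    then show ?thesis
      using t(2) by simp
  qed
  then show "\<exists>\<delta>>0. \<forall>F\<in>closed_bounded_sets. \<forall>G\<in>closed_bounded_sets.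
      hausdorff_dist F G < \<delta> \<longrightarrow> hausdorff_dist (cent V F) (cent V G) < \<epsilon>"
    using \<epsilon> by (intro exI[of _ "\<epsilon> / 4"]) auto
qed

section \<open>Functionals on spaces of bounded continuous functions\<close>

lemma bounded_linear_bcontfun_times:
  "bounded_linear (bcontfun_times (e :: 'a::topological_space \<Rightarrow>\<^sub>C real))"
proof (rule bounded_linear_intro[where K = "norm e"])
  fix f :: "'a \<Rightarrow>\<^sub>C real"
  have "norm (apply_bcontfun e x * apply_bcontfun f x) \<le> norm f * norm e" for x
    using mult_mono[OF norm_bounded[of e x] norm_bounded[of f x]]
    by (simp add: abs_mult mult.commute)
  then show "norm (bcontfun_times e f) \<le> norm f * norm e"
    by (intro norm_bound) simp
qed (auto intro!: bcontfun_eqI simp: algebra_simps)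

text \<open>When \<phi> is integration against a signed measure, this multiplies the measure by the
  density \<open>e\<close>.\<close>

definition localize ::
  "('a::topological_space \<Rightarrow>\<^sub>C real) \<Rightarrow> (('a \<Rightarrow>\<^sub>C real) \<Rightarrow>\<^sub>L real) \<Rightarrow> (('a \<Rightarrow>\<^sub>C real) \<Rightarrow>\<^sub>L real)" where
  "localize e \<phi> = \<phi> o\<^sub>L Blinfun (bcontfun_times e)"

lemma localize_apply [simp]: "blinfun_apply (localize e \<phi>) f = blinfun_apply \<phi> (bcontfun_times e f)"
  by (simp add: localize_def bounded_linear_Blinfun_apply bounded_linear_bcontfun_times)

text \<open>Signed values suffice because the unit ball is symmetric: a bound for them extends to
  all \<open>x\<close> by scaling, and \<open>- x\<close> gives the absolute value.\<close>

lemma blinfun_real_norm_approx: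
  fixes \<phi> :: "'e::real_normed_vector \<Rightarrow>\<^sub>L real"
  assumes "0 < \<eta>"
  obtains x where "norm x \<le> 1" "norm \<phi> - \<eta> \<le> blinfun_apply \<phi> x"
proof (rule ccontr)
  assume "\<not> thesis"
  with that have less: "blinfun_apply \<phi> x < norm \<phi> - \<eta>" if "norm x \<le> 1" for x
    using \<open>norm x \<le> 1\<close> by force
  have "norm \<phi> \<le> norm \<phi> - \<eta>"
  proof (rule norm_blinfun_bound)
    show "0 \<le> norm \<phi> - \<eta>"
      using less[of 0] by (simp add: blinfun.zero_right)
    have *: "blinfun_apply \<phi> x \<le> (norm \<phi> - \<eta>) * norm x" for x
    proof (cases "x = 0")
      case False
      then show ?thesis
        using less[of "x /\<^sub>R norm x"] by (simp add: blinfun.scaleR_right field_simps)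
    qed (simp add: blinfun.zero_right)
    show "norm (blinfun_apply \<phi> x) \<le> (norm \<phi> - \<eta>) * norm x" for x
      using *[of x] *[of "- x"] by (simp add: blinfun.minus_right abs_le_iff)
  qed
  then show False
    using assms by simp
qed

lemma blinfun_real_le: "blinfun_apply \<phi> x \<le> norm \<phi> * norm x"
  for \<phi> :: "'e::real_normed_vector \<Rightarrow>\<^sub>L real"
  using norm_blinfun[of \<phi> x] by simp

definition partition_pair ::
  "('a::topological_space \<Rightarrow>\<^sub>C real) \<Rightarrow> ('a \<Rightarrow>\<^sub>C real) \<Rightarrow> bool" where
  "partition_pair e e' \<longleftrightarrow>
     (\<forall>x. 0 \<le> apply_bcontfun e x \<and> 0 \<le> apply_bcontfun e' x \<and> apply_bcontfun e x + apply_bcontfun e' x = 1)"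

text \<open>Choose \<open>h\<close> and \<open>h'\<close> nearly norming for the two pieces. The
  function \<open>e h + e' h'\<close> is pointwise a convex combination, hence in the unit ball, and
  \<phi> takes there the sum of the two nearly attained norms.\<close>

lemma norm_localize_add_le:
  assumes "partition_pair e e'"
  shows "norm (localize e \<phi>) + norm (localize e' \<phi>) \<le> norm \<phi>"
proof (rule field_le_epsilon)
  fix \<eta> :: real assume "0 < \<eta>"
  then have "0 < \<eta> / 2" by simp
  obtain h where h: "norm h \<le> 1" "norm (localize e \<phi>) - \<eta> / 2 \<le> blinfun_apply (localize e \<phi>) h"
    using blinfun_real_norm_approx[OF \<open>0 < \<eta> / 2\<close>] .
  obtain h' where h': "norm h' \<le> 1" "norm (localize e' \<phi>) - \<eta> / 2 \<le> blinfun_apply (localize e' \<phi>) h'"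
    using blinfun_real_norm_approx[OF \<open>0 < \<eta> / 2\<close>] .
  have "norm (bcontfun_times e h + bcontfun_times e' h') \<le> 1"
  proof (rule norm_bound)
    fix x
    have "\<bar>apply_bcontfun h x\<bar> \<le> 1" "\<bar>apply_bcontfun h' x\<bar> \<le> 1"
      using norm_bounded[of h x] norm_bounded[of h' x] h(1) h'(1) by auto
    moreover have e: "0 \<le> apply_bcontfun e x" "0 \<le> apply_bcontfun e' x"
      "apply_bcontfun e x + apply_bcontfun e' x = 1"
      using assms by (auto simp: partition_pair_def)
    ultimately have "\<bar>apply_bcontfun e x * apply_bcontfun h x\<bar> + \<bar>apply_bcontfun e' x * apply_bcontfun h' x\<bar>
        \<le> apply_bcontfun e x * 1 + apply_bcontfun e' x * 1"
      unfolding abs_mult by (intro add_mono mult_mono) auto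
    then show "norm (apply_bcontfun (bcontfun_times e h + bcontfun_times e' h') x) \<le> 1"
      using e(3) by simp
  qed
  then have "blinfun_apply \<phi> (bcontfun_times e h + bcontfun_times e' h') \<le> norm \<phi>"
    using blinfun_real_le[of \<phi>] mult_left_le[OF _ norm_ge_zero[of \<phi>]] order_trans by blast
  then show "norm (localize e \<phi>) + norm (localize e' \<phi>) \<le> norm \<phi> + \<eta>"
    using h(2) h'(2) by (simp add: blinfun.add_right)
qed

lemma localize_add:
  assumes "partition_pair e e'"
  shows "localize e \<phi> + localize e' \<phi> = \<phi>"
proof (rule blinfun_eqI)
  fix f
  have "bcontfun_times e f + bcontfun_times e' f = f"
    using assms by (intro bcontfun_eqI) (simp add: partition_pair_def flip: distrib_right)
  then show "blinfun_apply (localize e \<phi> + localize e' \<phi>) f = blinfun_apply \<phi> f"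
    by (metis blinfun.add_left blinfun.add_right localize_apply)
qed

text \<open>A positive functional attains its norm at the constant \<open>1\<close>, so this is positivity up to \<open>\<eta>\<close>.
  Working up to \<open>\<eta>\<close> avoids the Jordan decomposition of functionals.\<close>
definition almost_positive :: "real \<Rightarrow> (('a::topological_space \<Rightarrow>\<^sub>C real) \<Rightarrow>\<^sub>L real) \<Rightarrow> bool" where
  "almost_positive \<eta> \<psi> \<longleftrightarrow> norm \<psi> - \<eta> \<le> blinfun_apply \<psi> (const_bcontfun 1)"

lemma norm_const_bcontfun_le: "norm (const_bcontfun c :: 'a::topological_space \<Rightarrow>\<^sub>C real) \<le> \<bar>c\<bar>"
  by (rule norm_bound) simp

lemma blinfun_const_one_le:
  fixes \<psi> :: "('a::topological_space \<Rightarrow>\<^sub>C real) \<Rightarrow>\<^sub>L real"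
  shows "blinfun_apply \<psi> (const_bcontfun 1) \<le> norm \<psi>"
  using blinfun_real_le[of \<psi> "const_bcontfun 1"] norm_const_bcontfun_le[of 1, where 'a = 'a]
    mult_left_le[OF _ norm_ge_zero[of \<psi>]]
  by (metis abs_one order_trans)

text \<open>The function \<open>norm p - p\<close> has norm at most \<open>norm p\<close>, so \<psi>
  is at most \<open>norm \<psi> * norm p\<close> there. At the constant \<open>norm p\<close> it
  falls short of this by at most \<open>\<eta> * norm p\<close>; subtracting gives the bound at
  \<open>p\<close>.\<close>

lemma almost_positive_apply:
  assumes "almost_positive \<eta> \<psi>" and "\<And>x. 0 \<le> apply_bcontfun p x"
  shows "- \<eta> * norm p \<le> blinfun_apply \<psi> p"
proof -
  let ?q = "norm p *\<^sub>R const_bcontfun 1 - p"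
  have "norm ?q \<le> norm p"
    using norm_bounded[of p] assms(2) by (intro norm_bound) (simp add: abs_le_iff)
  then have "blinfun_apply \<psi> ?q \<le> norm \<psi> * norm p"
    using blinfun_real_le[of \<psi> ?q] by (meson mult_left_mono norm_ge_zero order_trans)
  moreover have "(norm \<psi> - \<eta>) * norm p \<le> blinfun_apply \<psi> (const_bcontfun 1) * norm p"
    using assms(1) by (intro mult_right_mono) (auto simp: almost_positive_def)
  ultimately show ?thesis
    by (simp add: blinfun.diff_right blinfun.scaleR_right algebra_simps)
qed

text \<open>The defect, norm minus value at \<open>1\<close>, is non-negative for each piece. Values
  add up exactly and norms to at most \<open>norm \<psi>\<close>, so the two defects together are at
  most that of \<psi>, hence at most \<eta>.\<close>

lemma almost_positive_localize:
  assumes "almost_positive \<eta> \<psi>" "partition_pair e e'"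
  shows "almost_positive \<eta> (localize e \<psi>)" "almost_positive \<eta> (localize e' \<psi>)"
proof -
  let ?one = "const_bcontfun 1"
  have "blinfun_apply (localize e \<psi>) ?one + blinfun_apply (localize e' \<psi>) ?one = blinfun_apply \<psi> ?one"
    using localize_add[OF assms(2)] by (metis blinfun.add_left)
  moreover note bound = blinfun_const_one_le
  ultimately show "almost_positive \<eta> (localize e \<psi>)" "almost_positive \<eta> (localize e' \<psi>)"
    using norm_localize_add_le[OF assms(2), of \<psi>] assms(1)
      bound[of "localize e \<psi>"] bound[of "localize e' \<psi>"]
    unfolding almost_positive_def by linarith+
qed

section \<open>Order bounds in the bidual\<close>

lemma bcontfun_compose_obtain:
  fixes \<phi> :: "real \<Rightarrow> real" and f :: "'a::topological_space \<Rightarrow>\<^sub>C real"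
  assumes "continuous_on UNIV \<phi>"
  obtains g where "\<And>x. apply_bcontfun g x = \<phi> (apply_bcontfun f x)"
proof -
  have "compact (\<phi> ` cball 0 (norm f))"
    using assms by (intro compact_continuous_image) (auto intro: continuous_on_subset)
  moreover have "range (\<lambda>x. \<phi> (apply_bcontfun f x)) \<subseteq> \<phi> ` cball 0 (norm f)"
    using norm_bounded[of f] by auto
  ultimately have "bounded (range (\<lambda>x. \<phi> (apply_bcontfun f x)))"
    using bounded_subset compact_imp_bounded by blast
  moreover have "continuous_on UNIV (\<lambda>x. \<phi> (apply_bcontfun f x))"
    by (rule continuous_on_compose2[OF assms]) auto
  ultimately have "(\<lambda>x. \<phi> (apply_bcontfun f x)) \<in> bcontfun"
    by (simp add: bcontfun_def)
  then show thesis
    by (metis bcontfunE that)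
qed

lemma partition_pair_min:
  fixes f g :: "'a::topological_space \<Rightarrow>\<^sub>C real"
  assumes "0 < \<epsilon>"
  obtains e e' where "partition_pair e e'"
    "\<And>x. apply_bcontfun e x * apply_bcontfun f x + apply_bcontfun e' x * apply_bcontfun g x
      \<le> min (apply_bcontfun f x) (apply_bcontfun g x) + \<epsilon>"
proof -
  \<comment> \<open>A ramp from \<open>0\<close> at \<open>- \<epsilon>\<close> to \<open>1\<close>
    at \<open>\<epsilon>\<close>. Applied to \<open>g - f\<close>, it gives all weight to the
    smaller function where the two differ by at least \<epsilon>; elsewhere any weights cost at most
    \<epsilon>.\<close>
  define \<theta> :: "real \<Rightarrow> real" where "\<theta> t = max 0 (min 1 (t / (2 * \<epsilon>) + 1 / 2))" for t
  have "continuous_on UNIV \<theta>"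
    unfolding \<theta>_def using assms by (intro continuous_intros) auto
  then obtain e where e: "\<And>x. apply_bcontfun e x = \<theta> (apply_bcontfun (g - f) x)"
    using bcontfun_compose_obtain by blast
  let ?e' = "const_bcontfun 1 - e"
  have \<theta>: "0 \<le> \<theta> t" "\<theta> t \<le> 1" for t
    by (auto simp: \<theta>_def)
  have key: "\<theta> (b - a) * a + (1 - \<theta> (b - a)) * b \<le> min a b + \<epsilon>" for a b :: real
  proof -
    consider "b - a \<ge> \<epsilon>" | "b - a \<le> - \<epsilon>" | "\<bar>b - a\<bar> \<le> \<epsilon>"
      by linarith
    then show ?thesis
    proof cases
      case 1
      then have "\<theta> (b - a) = 1"
        using assms by (auto simp: \<theta>_def field_simps)
      then show ?thesis
        using 1 assms by simp
    next
      case 2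
      then have "\<theta> (b - a) = 0"
        using assms by (auto simp: \<theta>_def field_simps)
      then show ?thesis
        using 2 assms by simp
    next
      case 3
      have "\<theta> (b - a) * a + (1 - \<theta> (b - a)) * b \<le> \<theta> (b - a) * max a b + (1 - \<theta> (b - a)) * max a b"
        using \<theta>[of "b - a"] by (intro add_mono mult_left_mono) auto
      also have "\<dots> = max a b"
        by (simp add: algebra_simps)
      also have "\<dots> \<le> min a b + \<epsilon>"
        using 3 by linarith
      finally show ?thesis .
    qed
  qed
  show thesis
  proof (rule that[of e ?e'])
    show "partition_pair e ?e'"
      using \<theta> by (simp add: partition_pair_def e)
    show "apply_bcontfun e x * apply_bcontfun f x + apply_bcontfun ?e' x * apply_bcontfun g x
      \<le> min (apply_bcontfun f x) (apply_bcontfun g x) + \<epsilon>" for x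
      using key[of "apply_bcontfun g x" "apply_bcontfun f x"] by (simp add: e)
  qed
qed

text \<open>As in the Riesz decomposition property, \<open>\<psi>\<close> is split by a partition of unity whose two
  members are concentrated where \<open>f + a\<close>, respectively \<open>g + b\<close>, is the smaller function.\<close>
lemma bidual_le_min:
  fixes z :: "(('a::topological_space \<Rightarrow>\<^sub>C real) \<Rightarrow>\<^sub>L real) \<Rightarrow>\<^sub>L real"
  assumes f: "\<And>\<psi>. blinfun_apply z \<psi> \<le> blinfun_apply \<psi> f + a * norm \<psi>"
    and g: "\<And>\<psi>. blinfun_apply z \<psi> \<le> blinfun_apply \<psi> g + b * norm \<psi>"
    and h: "\<And>x. min (apply_bcontfun f x + a) (apply_bcontfun g x + b) \<le> apply_bcontfun h x + c"
    and "0 \<le> a" "0 \<le> b"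
  obtains K where "0 \<le> K" "\<And>\<eta> \<psi>. 0 < \<eta> \<Longrightarrow> almost_positive \<eta> \<psi> \<Longrightarrow>
    blinfun_apply z \<psi> \<le> blinfun_apply \<psi> h + c * blinfun_apply \<psi> (const_bcontfun 1) + K * \<eta>"
proof -
  let ?one = "const_bcontfun 1 :: 'a \<Rightarrow>\<^sub>C real"
  \<comment> \<open>Adding constants turns the error terms into values: for almost positive \<psi>,
    \<open>a * norm \<psi>\<close> exceeds the value of \<psi> at the constant \<open>a\<close> by
    at most \<open>a * \<eta>\<close>.\<close>
  define f' g' h' where "f' = f + a *\<^sub>R ?one" "g' = g + b *\<^sub>R ?one" "h' = h + c *\<^sub>R ?one"
  \<comment> \<open>Fixed before \<eta> and \<psi>. The part \<open>a + b\<close> pays for replacing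
    norms by values at \<open>1\<close> on the two pieces; the three norms bound, up to \<epsilon>,
    the non-negative function \<open>h' + \<epsilon> - ?m\<close> to which almost positivity is
    applied.\<close>
  define K where "K = a + b + norm h' + norm f' + norm g'"
  have "blinfun_apply z \<psi> \<le> blinfun_apply \<psi> h' + K * \<eta>"
    if \<eta>: "0 < \<eta>" and \<psi>: "almost_positive \<eta> \<psi>" for \<eta> \<psi>
  proof (rule field_le_epsilon)
    fix \<epsilon>' :: real assume \<epsilon>': "0 < \<epsilon>'"
    \<comment> \<open>Two errors come from \<epsilon>: \<epsilon> times the value of \<psi> at
      \<open>1\<close>, at most \<open>\<epsilon> * norm \<psi>\<close>, and
      \<open>\<eta> * \<epsilon>\<close>. This choice keeps their sum within
      \<open>\<epsilon>'\<close>.\<close>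
    define \<epsilon> where "\<epsilon> = \<epsilon>' / (norm \<psi> + \<eta> + 1)"
    have \<epsilon>: "0 < \<epsilon>" "\<epsilon> * (norm \<psi> + \<eta>) \<le> \<epsilon>'"
      using \<epsilon>' \<eta> norm_ge_zero[of \<psi>] by (auto simp: \<epsilon>_def field_simps simp del: norm_ge_zero)
    obtain e e' where e: "partition_pair e e'" and
      le: "\<And>x. apply_bcontfun e x * apply_bcontfun f' x + apply_bcontfun e' x * apply_bcontfun g' x
        \<le> min (apply_bcontfun f' x) (apply_bcontfun g' x) + \<epsilon>"
      using partition_pair_min[OF \<epsilon>(1)] by blast
    note pos = almost_positive_localize[OF \<psi> e]
    let ?m = "bcontfun_times e f' + bcontfun_times e' g'"
    have e01: "\<bar>apply_bcontfun e x\<bar> \<le> 1" "\<bar>apply_bcontfun e' x\<bar> \<le> 1" for x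
      using e unfolding partition_pair_def by (smt (verit))+
    have "norm ?m \<le> norm f' + norm g'"
    proof (rule norm_bound)
      fix x
      have "\<bar>apply_bcontfun e x * apply_bcontfun f' x\<bar> \<le> 1 * norm f'"
        "\<bar>apply_bcontfun e' x * apply_bcontfun g' x\<bar> \<le> 1 * norm g'"
        unfolding abs_mult using e01[of x] norm_bounded[of f' x] norm_bounded[of g' x]
        by (intro mult_mono; simp)+
      then show "norm (apply_bcontfun ?m x) \<le> norm f' + norm g'"
        by simp
    qed
    moreover have "norm (h' + \<epsilon> *\<^sub>R ?one - ?m) \<le> norm h' + \<epsilon> * norm ?one + norm ?m"
      using norm_triangle_ineq4[of "h' + \<epsilon> *\<^sub>R ?one" ?m] norm_triangle_ineq[of h' "\<epsilon> *\<^sub>R ?one"] \<epsilon>(1)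
      by simp
    moreover have "\<epsilon> * norm ?one \<le> \<epsilon>"
      using \<epsilon>(1) norm_const_bcontfun_le[of 1, where 'a = 'a] by simp
    ultimately have "norm (h' + \<epsilon> *\<^sub>R ?one - ?m) \<le> norm h' + \<epsilon> + norm f' + norm g'"
      by linarith
    then have "\<eta> * norm (h' + \<epsilon> *\<^sub>R ?one - ?m) \<le> \<eta> * (norm h' + \<epsilon> + norm f' + norm g')"
      using \<eta> by simp
    moreover have "- \<eta> * norm (h' + \<epsilon> *\<^sub>R ?one - ?m) \<le> blinfun_apply \<psi> (h' + \<epsilon> *\<^sub>R ?one - ?m)"
    proof (rule almost_positive_apply[OF \<psi>])
      fix x
      show "0 \<le> apply_bcontfun (h' + \<epsilon> *\<^sub>R ?one - ?m) x"
        using le[of x] h[of x] by (simp add: f'_g'_h'_def)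
    qed
    ultimately have m: "blinfun_apply \<psi> ?m
        \<le> blinfun_apply \<psi> h' + \<epsilon> * blinfun_apply \<psi> ?one + \<eta> * (norm h' + \<epsilon> + norm f' + norm g')"
      by (simp add: blinfun.diff_right blinfun.add_right blinfun.scaleR_right)
    note one = blinfun_const_one_le[of \<psi>]
    have "a * norm (localize e \<psi>) \<le> a * (blinfun_apply (localize e \<psi>) ?one + \<eta>)"
      "b * norm (localize e' \<psi>) \<le> b * (blinfun_apply (localize e' \<psi>) ?one + \<eta>)"
      using pos \<open>0 \<le> a\<close> \<open>0 \<le> b\<close> by (auto simp: almost_positive_def intro!: mult_left_mono)
    then have "blinfun_apply z (localize e \<psi>) \<le> blinfun_apply (localize e \<psi>) f' + a * \<eta>"
      "blinfun_apply z (localize e' \<psi>) \<le> blinfun_apply (localize e' \<psi>) g' + b * \<eta>"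
      using f[of "localize e \<psi>"] g[of "localize e' \<psi>"]
      unfolding f'_g'_h'_def blinfun.add_right blinfun.scaleR_right
      by (auto simp: distrib_left simp del: localize_apply)
    moreover have "blinfun_apply z \<psi> = blinfun_apply z (localize e \<psi>) + blinfun_apply z (localize e' \<psi>)"
      by (metis blinfun.add_right localize_add[OF e])
    ultimately have "blinfun_apply z \<psi> \<le> blinfun_apply \<psi> ?m + (a + b) * \<eta>"
      by (simp add: blinfun.add_right distrib_right)
    also have "\<dots> \<le> blinfun_apply \<psi> h' + \<epsilon> * (norm \<psi> + \<eta>) + K * \<eta>"
      using m mult_left_mono[OF one less_imp_le[OF \<epsilon>(1)]]
      by (simp add: K_def algebra_simps)
    finally show "blinfun_apply z \<psi> \<le> blinfun_apply \<psi> h' + K * \<eta> + \<epsilon>'"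
      using \<epsilon>(2) by simp
  qed
  moreover have "0 \<le> K"
    using assms(4,5) by (simp add: K_def)
  ultimately show thesis
    by (intro that[of K]) (auto simp: f'_g'_h'_def blinfun.add_right blinfun.scaleR_right)
qed

text \<open>The one-sided bound is two-sided because \<psi> may be replaced by its negative. This
  turns distances to embedded functions into order bounds to which \<open>bidual_le_min\<close>
  applies.\<close>

lemma norm_bidual_diff_le_iff:
  fixes z :: "('e::real_normed_vector \<Rightarrow>\<^sub>L real) \<Rightarrow>\<^sub>L real"
  assumes "0 \<le> a"
  shows "norm (bidual_embedding f - z) \<le> a \<longleftrightarrow>
    (\<forall>\<psi>. blinfun_apply z \<psi> \<le> blinfun_apply \<psi> f + a * norm \<psi>)" (is "?L \<longleftrightarrow> ?R")
proof
  assume ?L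
  show ?R
  proof
    fix \<psi>
    have "\<bar>blinfun_apply \<psi> f - blinfun_apply z \<psi>\<bar> \<le> a * norm \<psi>"
      using norm_blinfun[of "bidual_embedding f - z" \<psi>] mult_right_mono[OF \<open>?L\<close> norm_ge_zero[of \<psi>]]
      by (simp add: blinfun.diff_left)
    then show "blinfun_apply z \<psi> \<le> blinfun_apply \<psi> f + a * norm \<psi>"
      by linarith
  qed
next
  assume R: ?R
  show ?L
  proof (rule norm_blinfun_bound[OF assms])
    show "norm (blinfun_apply (bidual_embedding f - z) \<psi>) \<le> a * norm \<psi>" for \<psi>
      using R[rule_format, of \<psi>] R[rule_format, of "- \<psi>"]
      by (simp add: blinfun.diff_left blinfun.minus_left blinfun.minus_right abs_le_iff)
  qed
qed

text \<open>With \<open>k\<close> nearly norming for \<open>\<phi>\<close>, the weights \<open>(1 + k) / 2\<close> and \<open>(1 - k) / 2\<close> split \<open>\<phi>\<close>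
  into an almost positive and an almost negative part.\<close>
lemma almost_jordan_decomposition:
  fixes \<phi> :: "('a::topological_space \<Rightarrow>\<^sub>C real) \<Rightarrow>\<^sub>L real"
  assumes "0 < \<eta>"
  obtains \<psi> \<omega> where "\<phi> = \<psi> - \<omega>" "norm \<psi> + norm \<omega> \<le> norm \<phi>"
    "almost_positive \<eta> \<psi>" "almost_positive \<eta> \<omega>"
proof -
  let ?one = "const_bcontfun 1 :: 'a \<Rightarrow>\<^sub>C real"
  obtain k where k: "norm k \<le> 1" "norm \<phi> - \<eta> \<le> blinfun_apply \<phi> k"
    using blinfun_real_norm_approx[OF assms] .
  define e e' where "e = (1/2) *\<^sub>R (?one + k)" "e' = (1/2) *\<^sub>R (?one - k)"
  have k1: "\<bar>apply_bcontfun k x\<bar> \<le> 1" for x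
    using norm_bounded[of k x] k(1) by simp
  have e: "partition_pair e e'"
    unfolding partition_pair_def
  proof
    fix x
    show "0 \<le> apply_bcontfun e x \<and> 0 \<le> apply_bcontfun e' x \<and> apply_bcontfun e x + apply_bcontfun e' x = 1"
      using k1[of x] by (simp add: e_e'_def abs_le_iff field_simps)
  qed
  define \<psi> \<omega> where "\<psi> = localize e \<phi>" "\<omega> = - localize e' \<phi>"
  have sum: "\<phi> = \<psi> - \<omega>"
    using localize_add[OF e, of \<phi>] by (simp add: \<psi>_\<omega>_def)
  have norm: "norm \<psi> + norm \<omega> \<le> norm \<phi>"
    using norm_localize_add_le[OF e, of \<phi>] by (simp add: \<psi>_\<omega>_def)
  \<comment> \<open>Because \<open>e - e'\<close> is \<open>k\<close>, the values of \<psi> and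
    \<omega> at \<open>1\<close> add up to that of \<phi> at \<open>k\<close>, which is within
    \<eta> of \<open>norm \<phi>\<close>. Neither value exceeds its norm and the norms sum to at
    most \<open>norm \<phi>\<close>, so each falls short by at most \<eta>.\<close>
  have "bcontfun_times e ?one - bcontfun_times e' ?one = k"
    by (rule bcontfun_eqI) (simp add: e_e'_def field_simps)
  then have "blinfun_apply \<phi> k = blinfun_apply \<psi> ?one + blinfun_apply \<omega> ?one"
    by (auto simp: \<psi>_\<omega>_def blinfun.minus_left blinfun.diff_right)
  moreover note bound = blinfun_const_one_le
  ultimately have "almost_positive \<eta> \<psi>" "almost_positive \<eta> \<omega>"
    using norm k(2) bound[of \<psi>] bound[of \<omega>] unfolding almost_positive_def by linarith+
  then show thesis
    using that sum norm by blast
qed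

text \<open>The lower bound on \<open>u\<close> controls \<open>z\<close> on almost positive
  functionals. Negation turns the maximum in the upper bound into a minimum and so controls
  \<open>- z\<close>. Adding the estimates for \<open>z\<close> at \<psi> and \<open>- z\<close> at
  \<omega> bounds \<open>z\<close> at \<open>\<psi> - \<omega>\<close>.\<close>

lemma norm_bidual_embedding_truncation:
  fixes z :: "(('a::topological_space \<Rightarrow>\<^sub>C real) \<Rightarrow>\<^sub>L real) \<Rightarrow>\<^sub>L real"
  assumes w: "norm (bidual_embedding w - z) \<le> a"
    and v: "norm (bidual_embedding v - z) \<le> a + \<delta>"
    and "0 \<le> \<delta>"
    and lower: "\<And>x. min (apply_bcontfun w x) (apply_bcontfun v x + \<delta>) \<le> apply_bcontfun u x"
    and upper: "\<And>x. apply_bcontfun u x \<le> max (apply_bcontfun w x) (apply_bcontfun v x - \<delta>)"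
  shows "norm (bidual_embedding u - z) \<le> a"
proof -
  let ?one = "const_bcontfun 1 :: 'a \<Rightarrow>\<^sub>C real"
  have a: "0 \<le> a"
    using w norm_ge_zero order_trans by blast
  have w': "norm (bidual_embedding (- w) - (- z)) \<le> a"
    and v': "norm (bidual_embedding (- v) - (- z)) \<le> a + \<delta>"
  proof -
    have "bidual_embedding (- f) - (- z) = - (bidual_embedding f - z)" for f
      by (rule blinfun_eqI) (simp only: blinfun.diff_left blinfun.minus_left blinfun.minus_right bidual_embedding_apply)
    then show "norm (bidual_embedding (- w) - (- z)) \<le> a" "norm (bidual_embedding (- v) - (- z)) \<le> a + \<delta>"
      using w v by (metis norm_minus_cancel)+
  qed
  obtain K where K: "0 \<le> K" "\<And>\<eta> \<psi>. 0 < \<eta> \<Longrightarrow> almost_positive \<eta> \<psi> \<Longrightarrow>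
    blinfun_apply z \<psi> \<le> blinfun_apply \<psi> u + a * blinfun_apply \<psi> ?one + K * \<eta>"
  proof (rule bidual_le_min[of z w a v "a + \<delta>" u a])
    show "min (apply_bcontfun w x + a) (apply_bcontfun v x + (a + \<delta>)) \<le> apply_bcontfun u x + a" for x
      using lower[of x] by linarith
    show "blinfun_apply z \<psi> \<le> blinfun_apply \<psi> w + a * norm \<psi>" for \<psi>
      using w norm_bidual_diff_le_iff[OF a] by blast
    show "blinfun_apply z \<psi> \<le> blinfun_apply \<psi> v + (a + \<delta>) * norm \<psi>" for \<psi>
      using v norm_bidual_diff_le_iff[OF add_nonneg_nonneg[OF a \<open>0 \<le> \<delta>\<close>]] by blast
  qed (use a \<open>0 \<le> \<delta>\<close> in auto)
  obtain L where L: "0 \<le> L" "\<And>\<eta> \<psi>. 0 < \<eta> \<Longrightarrow> almost_positive \<eta> \<psi> \<Longrightarrow>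
    blinfun_apply (- z) \<psi> \<le> blinfun_apply \<psi> (- u) + a * blinfun_apply \<psi> ?one + L * \<eta>"
  proof (rule bidual_le_min[of "- z" "- w" a "- v" "a + \<delta>" "- u" a])
    show "min (apply_bcontfun (- w) x + a) (apply_bcontfun (- v) x + (a + \<delta>)) \<le> apply_bcontfun (- u) x + a" for x
      using upper[of x] by (simp add: min_def max_def split: if_splits)
    show "blinfun_apply (- z) \<psi> \<le> blinfun_apply \<psi> (- w) + a * norm \<psi>" for \<psi>
      using w' norm_bidual_diff_le_iff[OF a] by blast
    show "blinfun_apply (- z) \<psi> \<le> blinfun_apply \<psi> (- v) + (a + \<delta>) * norm \<psi>" for \<psi>
      using v' norm_bidual_diff_le_iff[OF add_nonneg_nonneg[OF a \<open>0 \<le> \<delta>\<close>]] by blast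
  qed (use a \<open>0 \<le> \<delta>\<close> in auto)
  note bound = blinfun_const_one_le
  have "blinfun_apply z \<phi> \<le> blinfun_apply \<phi> u + a * norm \<phi>" for \<phi>
  proof (rule field_le_epsilon)
    fix \<epsilon> :: real assume \<epsilon>: "0 < \<epsilon>"
    \<comment> \<open>\<open>K\<close> and \<open>L\<close> do not depend on \<eta>, so the total
      error \<open>(K + L) * \<eta>\<close> can be kept within \<epsilon>.\<close>
    define \<eta> where "\<eta> = \<epsilon> / (K + L + 1)"
    have \<eta>: "0 < \<eta>" "(K + L) * \<eta> \<le> \<epsilon>"
      using \<epsilon> K(1) L(1) by (auto simp: \<eta>_def field_simps)
    obtain \<psi> \<omega> where dec: "\<phi> = \<psi> - \<omega>" "norm \<psi> + norm \<omega> \<le> norm \<phi>"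
      "almost_positive \<eta> \<psi>" "almost_positive \<eta> \<omega>"
      using almost_jordan_decomposition[OF \<eta>(1)] .
    \<comment> \<open>The norms of \<psi> and \<omega> sum to at most \<open>norm \<phi>\<close>, so
      the two error terms together cost only \<open>a * norm \<phi>\<close>.\<close>
    have "a * (blinfun_apply \<psi> ?one + blinfun_apply \<omega> ?one) \<le> a * norm \<phi>"
      using bound[of \<psi>] bound[of \<omega>] dec(2) a by (intro mult_left_mono) auto
    then show "blinfun_apply z \<phi> \<le> blinfun_apply \<phi> u + a * norm \<phi> + \<epsilon>"
      using K(2)[OF \<eta>(1) dec(3)] L(2)[OF \<eta>(1) dec(4)] \<eta>(2)
      by (simp add: dec(1) blinfun.diff_left blinfun.diff_right blinfun.minus_left
          blinfun.minus_right algebra_simps)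
  qed
  then show ?thesis
    using norm_bidual_diff_le_iff[OF a] by blast
qed

section \<open>Closed subalgebras\<close>

text \<open>Sums start at \<open>i = 1\<close> because the constants may be missing from
  \<open>A\<close>: the polynomials applied to \<open>f\<close> must have no constant term.\<close>

lemma closed_subalgebra_power_sum:
  assumes A: "closed_subalgebra A" "f \<in> A"
  shows "\<exists>g\<in>A. \<forall>x. apply_bcontfun g x = (\<Sum>i\<in>{1..n}. c i * apply_bcontfun f x ^ i)"
proof -
  have sub: "subspace A" and mult: "\<And>f g. f \<in> A \<Longrightarrow> g \<in> A \<Longrightarrow> bcontfun_times f g \<in> A"
    using A(1) by (auto simp: closed_subalgebra_def)
  have power: "\<exists>g\<in>A. \<forall>x. apply_bcontfun g x = apply_bcontfun f x ^ Suc i" for i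
  proof (induction i)
    case 0
    then show ?case
      using A(2) by auto
  next
    case (Suc i)
    then obtain g where g: "g \<in> A" "\<And>x. apply_bcontfun g x = apply_bcontfun f x ^ Suc i"
      by blast
    then show ?case
      using mult[OF A(2) g(1)] by (intro bexI[of _ "bcontfun_times f g"]) auto
  qed
  show ?thesis
  proof (induction n)
    case 0
    then show ?case
      using subspace_0[OF sub] by (intro bexI[of _ 0]) auto
  next
    case (Suc n)
    then obtain g where g: "g \<in> A" "\<And>x. apply_bcontfun g x = (\<Sum>i\<in>{1..n}. c i * apply_bcontfun f x ^ i)"
      by blast
    obtain h where h: "h \<in> A" "\<And>x. apply_bcontfun h x = apply_bcontfun f x ^ Suc n"
      using power by blast
    show ?case
      using subspace_add[OF sub g(1) subspace_scale[OF sub h(1)]] g(2) h(2)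
      by (intro bexI[of _ "g + c (Suc n) *\<^sub>R h"]) auto
  qed
qed

lemma closed_subalgebra_compose:
  fixes \<theta> :: "real \<Rightarrow> real"
  assumes A: "closed_subalgebra A" "f \<in> A" and \<theta>: "continuous_on UNIV \<theta>" "\<theta> 0 = 0"
    and g: "\<And>x. apply_bcontfun g x = \<theta> (apply_bcontfun f x)"
  shows "g \<in> A"
proof -
  have "closed A"
    using A(1) by (simp add: closed_subalgebra_def)
  moreover have "\<exists>y\<in>A. dist y g < \<epsilon>" if \<epsilon>: "0 < \<epsilon>" for \<epsilon> :: real
  proof -
    \<comment> \<open>One quarter of \<epsilon> is for the approximation and one for the dropped
      constant term; their sum \<open>\<epsilon> / 2\<close> leaves room for a strict inequality
      after the supremum.\<close>
    obtain p where p: "real_polynomial_function p"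
      "\<And>t. t \<in> cball 0 (norm f) \<Longrightarrow> \<bar>\<theta> t - p t\<bar> < \<epsilon> / 4"
      using Stone_Weierstrass_real_polynomial_function[of "cball 0 (norm f)" \<theta> "\<epsilon> / 4"]
        \<epsilon> continuous_on_subset[OF \<theta>(1)] by auto
    obtain c n where c: "p = (\<lambda>t. \<Sum>i\<le>n. c i * t ^ i)"
      using p(1) real_polynomial_function_iff_sum by blast
    have split: "p t = c 0 + (\<Sum>i\<in>{1..n}. c i * t ^ i)" for t
      unfolding c by (simp add: sum.atMost_shift sum.atLeast1_atMost_eq lessThan_Suc_atMost)
    obtain h where h: "h \<in> A" "\<And>x. apply_bcontfun h x = (\<Sum>i\<in>{1..n}. c i * apply_bcontfun f x ^ i)"
      using closed_subalgebra_power_sum[OF A, of c n] by blast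
    have "p 0 = c 0"
      unfolding split by simp
    then have c0: "\<bar>c 0\<bar> < \<epsilon> / 4"
      using p(2)[of 0] \<theta>(2) by simp
    have "dist (apply_bcontfun h x) (apply_bcontfun g x) \<le> \<epsilon> / 2" for x
    proof -
      have "p (apply_bcontfun f x) = c 0 + apply_bcontfun h x"
        by (simp only: split h(2))
      moreover have "\<bar>\<theta> (apply_bcontfun f x) - p (apply_bcontfun f x)\<bar> < \<epsilon> / 4"
        using p(2) norm_bounded[of f x] by simp
      ultimately show ?thesis
        using c0 unfolding g dist_real_def by linarith
    qed
    then have "dist h g \<le> \<epsilon> / 2"
      by (rule dist_bound)
    then show ?thesis
      using h(1) \<epsilon> by (intro bexI[of _ h]) auto
  qed
  ultimately show ?thesis
    using closed_approachable by blast
qed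

section \<open>Completeness of the embedded unit ball\<close>

lemma complete_UNIV_bcontfun: "complete (UNIV :: ('a::topological_space \<Rightarrow>\<^sub>C 'b::complete_space) set)"
  unfolding complete_def
proof (intro allI impI)
  fix f :: "nat \<Rightarrow> 'a \<Rightarrow>\<^sub>C 'b"
  assume "(\<forall>n. f n \<in> UNIV) \<and> Cauchy f"
  then have "uniformly_Cauchy_on UNIV (\<lambda>n. apply_bcontfun (f n))"
    unfolding uniformly_Cauchy_on_def Cauchy_def by (meson dist_bounded le_less_trans)
  then obtain l where "uniform_limit UNIV (\<lambda>n. apply_bcontfun (f n)) l sequentially"
    using Cauchy_uniformly_convergent uniformly_convergent_on_def by blast
  then show "\<exists>l\<in>UNIV. f \<longlonglongrightarrow> l"
    by (metis UNIV_I sequentially_bot uniform_limit_bcontfunE)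
qed

lemma bounded_linear_bidual_embedding:
  "bounded_linear (bidual_embedding :: 'e::real_normed_vector \<Rightarrow> _)"
proof (rule bounded_linear_intro[where K = 1])
  fix x :: 'e
  have "norm (blinfun_apply (bidual_embedding x) \<psi>) \<le> norm x * norm \<psi>" for \<psi>
    using norm_blinfun[of \<psi> x] by (simp add: mult.commute)
  then show "norm (bidual_embedding x) \<le> norm x * 1"
    by (simp add: norm_blinfun_bound)
qed (auto intro!: blinfun_eqI simp: blinfun.add_left blinfun.add_right
    blinfun.scaleR_left blinfun.scaleR_right)

text \<open>Point evaluations are functionals of norm at most \<open>1\<close>, and testing the
  embedded function against them already recovers its supremum norm.\<close>

lemma norm_bidual_embedding_bcontfun:
  "norm (bidual_embedding (f :: 'a::topological_space \<Rightarrow>\<^sub>C real)) = norm f"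
proof (rule antisym)
  show "norm (bidual_embedding f) \<le> norm f"
  proof (rule norm_blinfun_bound)
    show "norm (blinfun_apply (bidual_embedding f) \<psi>) \<le> norm f * norm \<psi>" for \<psi>
      using norm_blinfun[of \<psi> f] by (simp add: mult.commute)
  qed simp
  show "norm f \<le> norm (bidual_embedding f)"
  proof (rule norm_bound)
    fix x
    have bl: "bounded_linear (\<lambda>f :: 'a \<Rightarrow>\<^sub>C real. apply_bcontfun f x)"
      by (rule bounded_linear_intro[where K = 1]) (auto simp: norm_bounded simp del: real_norm_def)
    define \<phi> where "\<phi> = Blinfun (\<lambda>f :: 'a \<Rightarrow>\<^sub>C real. apply_bcontfun f x)"
    have \<phi>: "blinfun_apply \<phi> g = apply_bcontfun g x" for g
      using bl by (simp add: \<phi>_def bounded_linear_Blinfun_apply)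
    have "norm \<phi> \<le> 1"
    proof (rule norm_blinfun_bound)
      show "norm (blinfun_apply \<phi> g) \<le> 1 * norm g" for g
        using norm_bounded[of g x] by (simp add: \<phi>)
    qed simp
    then have "norm (bidual_embedding f) * norm \<phi> \<le> norm (bidual_embedding f)"
      by (simp add: mult_left_le)
    then show "norm (apply_bcontfun f x) \<le> norm (bidual_embedding f)"
      using norm_blinfun[of "bidual_embedding f" \<phi>] by (simp add: \<phi>)
  qed
qed

lemma complete_bidual_unit_ball:
  fixes A :: "('a::topological_space \<Rightarrow>\<^sub>C real) set"
  assumes "closed_subalgebra A"
  shows "complete (bidual_embedding ` (A \<inter> cball 0 1))"
proof -
  have "complete A"
    using complete_Int_closed[OF complete_UNIV_bcontfun, of A] assms
    by (simp add: closed_subalgebra_def)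
  then have "complete (bidual_embedding ` A)"
    using assms bounded_linear_bidual_embedding
    by (intro complete_isometric_image[of 1])
      (auto simp: closed_subalgebra_def norm_bidual_embedding_bcontfun)
  moreover have "bidual_embedding ` (A \<inter> cball 0 1) = bidual_embedding ` A \<inter> cball 0 1"
    by (auto simp: norm_bidual_embedding_bcontfun)
  ultimately show ?thesis
    by (simp add: complete_Int_closed)
qed

section \<open>Truncation inside the unit ball of the algebra\<close>

lemma truncation_property_bidual_unit_ball:
  fixes A :: "('a::topological_space \<Rightarrow>\<^sub>C real) set"
  assumes A: "closed_subalgebra A"
  shows "truncation_property (bidual_embedding ` (A \<inter> cball 0 1))"
  unfolding truncation_property_def
proof (clarsimp, goal_cases)
  case (1 v w \<delta>)
  have sub: "subspace A"
    using A by (simp add: closed_subalgebra_def)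
  \<comment> \<open>Clamping \<open>w - v\<close> to the interval from \<open>- \<delta>\<close> to
    \<delta> and adding \<open>v\<close> truncates \<open>w\<close> to the band about
    \<open>v\<close>. The clamp fixes \<open>0\<close>, so the clamped difference stays in
    \<open>A\<close> even if \<open>A\<close> lacks the constants.\<close>
  define \<theta> :: "real \<Rightarrow> real" where "\<theta> t = max (- \<delta>) (min t \<delta>)" for t
  have \<theta>: "continuous_on UNIV \<theta>" "\<theta> 0 = 0"
    unfolding \<theta>_def using 1 by (auto intro!: continuous_intros)
  obtain d where d: "\<And>x. apply_bcontfun d x = \<theta> (apply_bcontfun (w - v) x)"
    using bcontfun_compose_obtain[OF \<theta>(1)] by blast
  have "d \<in> A"
    using closed_subalgebra_compose[OF A _ \<theta> d] subspace_diff[OF sub] 1 by blast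
  define u where "u = v + d"
  have "u \<in> A"
    using subspace_add[OF sub _ \<open>d \<in> A\<close>] 1 by (simp add: u_def)
  have "norm d \<le> \<delta>"
    using 1 by (intro norm_bound) (auto simp: d \<theta>_def)
  \<comment> \<open>At each point \<open>u\<close> lies between \<open>v\<close> and
    \<open>w\<close>, whose absolute values are at most \<open>1\<close>.\<close>
  have "norm u \<le> 1"
  proof (rule norm_bound)
    fix x
    have "\<bar>apply_bcontfun v x\<bar> \<le> 1" "\<bar>apply_bcontfun w x\<bar> \<le> 1"
      using norm_bounded[of v x] norm_bounded[of w x] 1 by auto
    then show "norm (apply_bcontfun u x) \<le> 1"
      using 1 by (auto simp: u_def d \<theta>_def max_def min_def abs_le_iff)
  qed
  have "norm (bidual_embedding u - z) \<le> a"
    if "norm (bidual_embedding w - z) \<le> a" "norm (bidual_embedding v - z) \<le> a + \<delta>" for z a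
  proof (rule norm_bidual_embedding_truncation[OF that])
    show "min (apply_bcontfun w x) (apply_bcontfun v x + \<delta>) \<le> apply_bcontfun u x"
      "apply_bcontfun u x \<le> max (apply_bcontfun w x) (apply_bcontfun v x - \<delta>)" for x
      using 1 by (auto simp: u_def d \<theta>_def max_def min_def)
  qed (use 1 in simp)
  moreover have "norm (bidual_embedding u - bidual_embedding v) \<le> \<delta>"
  proof -
    have "bidual_embedding u - bidual_embedding v = bidual_embedding d"
      by (rule blinfun_eqI) (simp add: u_def blinfun.diff_left blinfun.add_right)
    then show ?thesis
      using \<open>norm d \<le> \<delta>\<close> by (simp add: norm_bidual_embedding_bcontfun)
  qed
  ultimately show ?case
    using \<open>u \<in> A\<close> \<open>norm u \<le> 1\<close> by (intro bexI[of _ u]) auto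
qed

theorem corollary2p6:
  fixes A :: "('a::t2_space \<Rightarrow>\<^sub>C real) set"
  assumes "compact (UNIV :: 'a set)"
    and "closed_subalgebra A"
  shows "property_P1 (bidual_embedding ` (A \<inter> cball 0 1))
           (closed_bounded_sets :: ((('a \<Rightarrow>\<^sub>C real) \<Rightarrow>\<^sub>L real) \<Rightarrow>\<^sub>L real) set set)
       \<and> cent_uniformly_hausdorff_continuous (bidual_embedding ` (A \<inter> cball 0 1))"
proof -
  let ?V = "bidual_embedding ` (A \<inter> cball 0 1)"
  have "0 \<in> A"
    using assms(2) subspace_0 by (auto simp: closed_subalgebra_def)
  then have "?V \<noteq> {}"
    by auto
  moreover have "bounded ?V"
    by (rule bounded_subset[of "cball 0 1"]) (auto simp: norm_bidual_embedding_bcontfun)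
  ultimately show ?thesis
    using complete_bidual_unit_ball[OF assms(2)] truncation_property_bidual_unit_ball[OF assms(2)]
      truncation_property_imp_P1 truncation_property_imp_uniformly_continuous by blast
qed

end
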